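(* Let $\Sigma$ be a finite alphabet of size $q$, let $d\ge 2$, and let $f_1,\dots,f_n:\Sigma^d\to\Sigma$ be bipermutive local rules forming a family of $n$ mutually orthogonal cellular automata ($n$-MOCA), with associated no-boundary cellular automata $F_1,\dots,F_n:\Sigma^{2(d-1)}\to\Sigma^{d-1}$. Consider the modified MOCA-based scheme (described in full in the context), in which the dealer chooses a secret rule index $S\in\{1,\dots,n\}$, selects a random output block $R\in\Sigma^{d-1}$ (with uniform probability), and, denoting $F_S^{-1}(R)=\{B_1,\dots,B_{q^{d-1}}\}$, distributes the share $B_i$ to player $P_i$ for every $i\in\{1,\dots,q^{d-1}\}$. Then this scheme is a perfect and anonymous $(2,q^{d-1})$ threshold secret sharing scheme.
   Context: A local rule $f:\Sigma^d\to\Sigma$ of diameter $d$ is bipermutive if, fixing $x_2,\dots,x_d$ to any constants, $x_1\mapsto f(x_1,\dots,x_d)$ is a permutation of $\Sigma$, and likewise, fixing $x_1,\dots,x_{d-1}$ to any constants, $x_d\mapsto f(x_1,\dots,x_d)$ is a permutation of $\Sigma$. The no-boundary cellular automaton $F:\Sigma^{2(d-1)}\to\Sigma^{d-1}$ with local rule $f$ is $$F(x_1,\dots,x_{2(d-1)})=(f(x_1,\dots,x_d),f(x_2,\dots,x_{d+1}),\dots,f(x_{d-1},\dots,x_{2(d-1)})).$$ Its Cayley table is the $q^{d-1}\times q^{d-1}$ matrix with rows, columns and entries indexed by $\Sigma^{d-1}$, whose entry in row $u$ and column $v$ is $F(u\|v)$, where $\|$ denotes concatenation. If $f$ is bipermutive,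 this table is a Latin square (every row and every column is a permutation of $\Sigma^{d-1}$), and $|F^{-1}(y)|=q^{d-1}$ for every $y\in\Sigma^{d-1}$. Two Latin squares $L_1,L_2$ of the same order are orthogonal if $(L_1(u,v),L_2(u,v))\ne(L_1(u',v'),L_2(u',v'))$ for all distinct coordinates $(u,v)\neq(u',v')$. Bipermutive rules $f_1,\dots,f_n$ form a family of $n$-MOCA if for all $i\ne j$ the Cayley tables of $F_i$ and $F_j$ are orthogonal Latin squares. The scheme. The rules $f_1,\dots,f_n$ are public, the secret space is $\{f_1,\dots,f_n\}$, the share space is $\Sigma^{2(d-1)}$, and there are $q^{d-1}$ players $P_1,\dots,P_{q^{d-1}}$. Setup: the dealer chooses the secret index $S$, selects the random block $R\in\Sigma^{d-1}$, computes the counterimage $F_S^{-1}(R)=\{x\in\Sigma^{2(d-1)}:F_S(x)=R\}$, denotes its elements by $B_1,\dots,B_{q^{d-1}}$, and gives $B_i$ to $P_i$ for every $i$. Recovery by two players $P_i,P_j$: without interacting, $P_i$ computes, for every $k\in\{1,\dots,n\}$, $y_{i,k}=F_k(B_i)$ and the set $A_{i,k}=F_k^{-1}(y_{i,k})$, obtaining the family $\mathcal{A}_i=\{A_{i,1},\dots,A_{i,n}\}$; $P_j$ computes $\mathcal{A}_j=\{A_{j,1},\dots,A_{j,n}\}$ in the same way from $B_j$. Then they compute $\mathcal{A}_i\cap\mathcal{A}_j$, and the result identifies the secret rule as the rule $f_k$ to whose partition $\{F_k^{-1}(y):y\in\Sigma^{d-1}\}$ of $\Sigma^{2(d-1)}$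 the resulting subset belongs. Terminology. A $(t,m)$ threshold scheme is a secret sharing scheme with $m$ players in which the authorized sets (those that can recover the secret by pooling their shares) are exactly the sets of at least $t$ players. With the secret drawn according to a probability distribution $\Pr(S)$, the scheme is perfect if knowing the shares of any unauthorized set $U$ leaks no information on the secret, i.e. $\Pr(S\mid U)=\Pr(S)$. It is anonymous if the secret can be recovered only as a function of the values of the shares, without associating them to the players' identities.
   Formalization: We assume n ≥ 2 (for n = 1 the empty set of players already knows the secret) and take the labelling B_1,…,B_{q^{d-1}} of the counterimage uniformly at random, since a labelling depending on S could reveal S from a single share. *)

theory Defs
  imports "HOL-Probability.Probability"
begin

text \<open>
  The distribution of the secret is not part of a scheme; perfectness quantifies over it.
\<close>

record ('s, 'p, 'b) sharing_scheme =
  secrets :: "'s set"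
  players :: "'p set"
  deal :: "'s \<Rightarrow> ('p \<Rightarrow> 'b) pmf"

definition can_recover :: "('s, 'p, 'b) sharing_scheme \<Rightarrow> 'p set \<Rightarrow> bool" where
  "can_recover \<S> U \<longleftrightarrow>
     (\<exists>g. \<forall>s\<in>secrets \<S>. \<forall>B\<in>set_pmf (deal \<S> s). g (restrict B U) = s)"

definition threshold_scheme :: "nat \<Rightarrow> nat \<Rightarrow> ('s, 'p, 'b) sharing_scheme \<Rightarrow> bool" where
  "threshold_scheme t m \<S> \<longleftrightarrow>
     finite (players \<S>) \<and> card (players \<S>) = m \<and>
     (\<forall>U\<subseteq>players \<S>. can_recover \<S> U \<longleftrightarrow> t \<le> card U)"

definition secret_and_shares ::
    "'s pmf \<Rightarrow> ('s, 'p, 'b) sharing_scheme \<Rightarrow> ('s \<times> ('p \<Rightarrow> 'b)) pmf" where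
  "secret_and_shares p \<S> = bind_pmf p (\<lambda>s. map_pmf (\<lambda>B. (s, B)) (deal \<S> s))"

definition perfect_scheme :: "('s, 'p, 'b) sharing_scheme \<Rightarrow> bool" where
  "perfect_scheme \<S> \<longleftrightarrow>
     (\<forall>p. set_pmf p \<subseteq> secrets \<S> \<longrightarrow>
       (\<forall>U\<subseteq>players \<S>. \<not> can_recover \<S> U \<longrightarrow>
         (\<forall>v. \<P>(\<omega> in secret_and_shares p \<S>. restrict (snd \<omega>) U = v) > 0 \<longrightarrow>
           (\<forall>s\<in>secrets \<S>.
             \<P>(\<omega> in secret_and_shares p \<S>. fst \<omega> = s \<bar> restrict (snd \<omega>) U = v) = pmf p s))))"

text \<open>
  The recovery function \<open>g\<close> sees only the multiset of pooled share values, and it must be the same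
  for all authorized sets.
\<close>

definition anonymous_scheme :: "('s, 'p, 'b) sharing_scheme \<Rightarrow> bool" where
  "anonymous_scheme \<S> \<longleftrightarrow>
     (\<exists>g. \<forall>U\<subseteq>players \<S>. can_recover \<S> U \<longrightarrow>
       (\<forall>s\<in>secrets \<S>. \<forall>B\<in>set_pmf (deal \<S> s). g (image_mset B (mset_set U)) = s))"

definition blocks :: "nat \<Rightarrow> 'a list set" where
  "blocks k = {xs. length xs = k}"

text \<open>
  A local rule of diameter \<open>d\<close> is a function on lists of which only the values on
  \<open>blocks d\<close> matter.
\<close>

definition bipermutive :: "nat \<Rightarrow> ('a list \<Rightarrow> 'a) \<Rightarrow> bool" where
  "bipermutive d f \<longleftrightarrow>
     (\<forall>xs\<in>blocks (d - 1). bij (\<lambda>x. f (x # xs)) \<and> bij (\<lambda>x. f (xs @ [x])))"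

definition nbca :: "nat \<Rightarrow> ('a list \<Rightarrow> 'a) \<Rightarrow> 'a list \<Rightarrow> 'a list" where
  "nbca d f xs = map (\<lambda>i. f (take d (drop i xs))) [0..<d - 1]"

definition cayley_table :: "nat \<Rightarrow> ('a list \<Rightarrow> 'a) \<Rightarrow> 'a list \<Rightarrow> 'a list \<Rightarrow> 'a list" where
  "cayley_table d f u v = nbca d f (u @ v)"

definition latin_square :: "'i set \<Rightarrow> ('i \<Rightarrow> 'i \<Rightarrow> 'i) \<Rightarrow> bool" where
  "latin_square X L \<longleftrightarrow>
     (\<forall>u\<in>X. bij_betw (\<lambda>v. L u v) X X) \<and> (\<forall>v\<in>X. bij_betw (\<lambda>u. L u v) X X)"

definition orthogonal_latin_squares ::
    "'i set \<Rightarrow> ('i \<Rightarrow> 'i \<Rightarrow> 'i) \<Rightarrow> ('i \<Rightarrow> 'i \<Rightarrow> 'i) \<Rightarrow> bool" where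
  "orthogonal_latin_squares X L1 L2 \<longleftrightarrow>
     latin_square X L1 \<and> latin_square X L2 \<and>
     inj_on (\<lambda>(u, v). (L1 u v, L2 u v)) (X \<times> X)"

definition moca :: "nat \<Rightarrow> nat \<Rightarrow> (nat \<Rightarrow> 'a list \<Rightarrow> 'a) \<Rightarrow> bool" where
  "moca n d f \<longleftrightarrow>
     (\<forall>i\<in>{1..n}. \<forall>j\<in>{1..n}. i \<noteq> j \<longrightarrow>
       orthogonal_latin_squares (blocks (d - 1)) (cayley_table d (f i)) (cayley_table d (f j)))"

definition counterimage :: "nat \<Rightarrow> ('a list \<Rightarrow> 'a) \<Rightarrow> 'a list \<Rightarrow> 'a list set" where
  "counterimage d f y = {x \<in> blocks (2 * (d - 1)). nbca d f x = y}"

definition labellings :: "nat \<Rightarrow> 'b set \<Rightarrow> (nat \<Rightarrow> 'b) set" where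
  "labellings m X = {B \<in> extensional {1..m}. bij_betw B {1..m} X}"

text \<open>
  The dealer labels the elements of the counterimage by the players uniformly at random. This
  matters: if the labelling were an arbitrary function of the secret and of the random output block, the share of a
  fixed player could reveal the secret.
\<close>

definition moca_scheme ::
    "nat \<Rightarrow> nat \<Rightarrow> (nat \<Rightarrow> 'a::finite list \<Rightarrow> 'a) \<Rightarrow> (nat, nat, 'a list) sharing_scheme" where
  "moca_scheme n d f =
     \<lparr>secrets = {1..n},
      players = {1..CARD('a) ^ (d - 1)},
      deal = (\<lambda>S. bind_pmf (pmf_of_set (blocks (d - 1)))
                (\<lambda>R. pmf_of_set (labellings (CARD('a) ^ (d - 1)) (counterimage d (f S) R))))\<rparr>"

definition share_family ::
    "nat \<Rightarrow> nat \<Rightarrow> (nat \<Rightarrow> 'a list \<Rightarrow> 'a) \<Rightarrow> 'a list \<Rightarrow> 'a list set set" where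
  "share_family n d f b = (\<lambda>k. counterimage d (f k) (nbca d (f k) b)) ` {1..n}"

definition ca_partition :: "nat \<Rightarrow> ('a list \<Rightarrow> 'a) \<Rightarrow> 'a list set set" where
  "ca_partition d f = counterimage d f ` blocks (d - 1)"

text \<open>
  The recovery procedure of two players, as a relation between their shares and the rule index
  they identify.
\<close>

definition identifies ::
    "nat \<Rightarrow> nat \<Rightarrow> (nat \<Rightarrow> 'a list \<Rightarrow> 'a) \<Rightarrow> 'a list \<Rightarrow> 'a list \<Rightarrow> nat \<Rightarrow> bool" where
  "identifies n d f b b' k \<longleftrightarrow>
     k \<in> {1..n} \<and>
     (\<exists>X. share_family n d f b \<inter> share_family n d f b' = {X} \<and> X \<in> ca_partition d (f k))"

definition recovery_correct :: "nat \<Rightarrow> nat \<Rightarrow> (nat \<Rightarrow> 'a::finite list \<Rightarrow> 'a) \<Rightarrow> bool" where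
  "recovery_correct n d f \<longleftrightarrow>
     (\<forall>S\<in>secrets (moca_scheme n d f). \<forall>B\<in>set_pmf (deal (moca_scheme n d f) S).
       \<forall>i\<in>players (moca_scheme n d f). \<forall>j\<in>players (moca_scheme n d f). i \<noteq> j \<longrightarrow>
         (\<forall>k. identifies n d f (B i) (B j) k \<longleftrightarrow> k = S))"

end

theory Submission
  imports Defs
begin

text \<open>
  Two distinct blocks with the same image under two different rules would contradict
  orthogonality, so any two shares determine the secret rule. The share of a single player is
  uniform on \<open>blocks (2 * (d - 1))\<close> whatever the secret is, because the counterimages of one
  rule split this set into classes of equal size.
\<close>

section \<open>Perfectness from secret-independent shares\<close>

text \<open>Independence of secret and view: on the support of \<open>p\<close> the view has the
  same law \<open>D\<close> for each secret, so the joint law is a product.\<close>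

lemma map_secret_and_shares:
  assumes "set_pmf p \<subseteq> secrets \<S>"
    and "\<And>s. s \<in> secrets \<S> \<Longrightarrow> map_pmf (\<lambda>B. restrict B U) (deal \<S> s) = D"
  shows "map_pmf (\<lambda>\<omega>. (fst \<omega>, restrict (snd \<omega>) U)) (secret_and_shares p \<S>) = pair_pmf p D"
proof -
  have "map_pmf (\<lambda>\<omega>. (fst \<omega>, restrict (snd \<omega>) U)) (secret_and_shares p \<S>)
      = bind_pmf p (\<lambda>s. map_pmf (Pair s) (map_pmf (\<lambda>B. restrict B U) (deal \<S> s)))"
    by (simp add: secret_and_shares_def map_bind_pmf pmf.map_comp o_def)
  also have "\<dots> = bind_pmf p (\<lambda>s. map_pmf (Pair s) D)"
    using assms by (intro bind_pmf_cong) auto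
  also have "\<dots> = pair_pmf p D"
    by (simp add: pair_pmf_def map_pmf_def)
  finally show ?thesis .
qed

text \<open>The joint law factors, so the conditional probability is
  \<open>pmf p s * pmf D v\<close> over \<open>pmf D v\<close>; positivity of the conditioning event
  allows the cancellation.\<close>

lemma cond_prob_secret:
  assumes "set_pmf p \<subseteq> secrets \<S>"
    and "\<And>s. s \<in> secrets \<S> \<Longrightarrow> map_pmf (\<lambda>B. restrict B U) (deal \<S> s) = D"
    and pos: "\<P>(\<omega> in secret_and_shares p \<S>. restrict (snd \<omega>) U = v) > 0"
  shows "\<P>(\<omega> in secret_and_shares p \<S>. fst \<omega> = s \<bar> restrict (snd \<omega>) U = v) = pmf p s"
proof -
  let ?M = "secret_and_shares p \<S>"
  let ?h = "\<lambda>\<omega>. (fst \<omega>, restrict (snd \<omega>) U)"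
  note joint = map_secret_and_shares[OF assms(1,2)]
  have "\<P>(\<omega> in ?M. fst \<omega> = s \<and> restrict (snd \<omega>) U = v) = pmf (map_pmf ?h ?M) (s, v)"
    by (simp add: pmf_map vimage_def)
  then have num: "\<P>(\<omega> in ?M. fst \<omega> = s \<and> restrict (snd \<omega>) U = v) = pmf p s * pmf D v"
    by (simp add: joint pmf_pair)
  have "\<P>(\<omega> in ?M. restrict (snd \<omega>) U = v) = pmf (map_pmf snd (map_pmf ?h ?M)) v"
    by (simp add: pmf_map vimage_def pmf.map_comp o_def)
  then have den: "\<P>(\<omega> in ?M. restrict (snd \<omega>) U = v) = pmf D v"
    by (simp add: joint map_snd_pair_pmf)
  show ?thesis
    using pos unfolding cond_prob_def num den by simp
qed

text \<open>A view in the support of \<open>D\<close> occurs under both secrets, so a recovery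
  function would need two values there.\<close>

lemma not_can_recover:
  assumes "\<And>s. s \<in> secrets \<S> \<Longrightarrow> map_pmf (\<lambda>B. restrict B U) (deal \<S> s) = D"
    and "s \<in> secrets \<S>" "s' \<in> secrets \<S>" "s \<noteq> s'"
  shows "\<not> can_recover \<S> U"
proof
  assume "can_recover \<S> U"
  then obtain g where g: "\<And>s B. s \<in> secrets \<S> \<Longrightarrow> B \<in> set_pmf (deal \<S> s) \<Longrightarrow> g (restrict B U) = s"
    unfolding can_recover_def by blast
  obtain v where "v \<in> set_pmf D"
    using set_pmf_not_empty by fast
  moreover have "g v = r" if "r \<in> secrets \<S>" "v \<in> set_pmf D" for r
    using that assms(1)[of r, symmetric] g by auto
  ultimately show False
    using assms(2-4) by blast
qed

section \<open>Uniform labellings\<close>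

text \<open>Since the fibres have equal size, a uniform element of \<open>A\<close> can be drawn by
  first choosing a fibre uniformly and then an element of it; \<open>h\<close> returns the chosen
  fibre.\<close>

lemma map_pmf_of_set_equal_fibres:
  assumes "finite A" "A \<noteq> {}" "h ` A = X"
    and "\<And>x. x \<in> X \<Longrightarrow> card {a \<in> A. h a = x} = c"
  shows "map_pmf h (pmf_of_set A) = pmf_of_set X"
proof -
  let ?F = "\<lambda>x. {a \<in> A. h a = x}"
  have A: "A = (\<Union>x\<in>X. ?F x)" and X: "finite X" "X \<noteq> {}"
    using assms by auto
  have "pmf_of_set (\<Union>x\<in>X. ?F x) = bind_pmf (pmf_of_set X) (\<lambda>x. pmf_of_set (?F x))"
    using assms A X by (intro pmf_of_set_UN[where n = c]) (auto simp: disjoint_family_on_def)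
  then have "map_pmf h (pmf_of_set A) =
      bind_pmf (pmf_of_set X) (\<lambda>x. map_pmf h (pmf_of_set (?F x)))"
    using A by (simp add: map_bind_pmf)
  also have "\<dots> = bind_pmf (pmf_of_set X) return_pmf"
  proof (intro bind_pmf_cong refl)
    fix x assume "x \<in> set_pmf (pmf_of_set X)"
    then have "?F x \<noteq> {}" "finite (?F x)"
      using X assms by auto
    then have "map_pmf h (pmf_of_set (?F x)) = map_pmf (\<lambda>_. x) (pmf_of_set (?F x))"
      by (intro map_pmf_cong) auto
    then show "map_pmf h (pmf_of_set (?F x)) = return_pmf x"
      by simp
  qed
  finally show ?thesis
    by (simp add: bind_return_pmf')
qed

lemma finite_labellings:
  assumes "finite X"
  shows "finite (labellings m X)"
proof (rule finite_subset)
  show "labellings m X \<subseteq> {1..m} \<rightarrow>\<^sub>E X"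
    by (auto simp: labellings_def PiE_def Pi_def dest: bij_betw_apply)
  show "finite ({1..m} \<rightarrow>\<^sub>E X)"
    using assms by (simp add: finite_PiE)
qed

lemma labellings_nonempty:
  assumes "finite X" "card X = m"
  shows "labellings m X \<noteq> {}"
proof -
  obtain B where "bij_betw B {1..m} X"
    using assms finite_same_card_bij[of "{1..m}" X] by auto
  then have "restrict B {1..m} \<in> labellings m X"
    by (simp add: labellings_def)
  then show ?thesis by blast
qed

text \<open>A transposition of two elements of \<open>X\<close> permutes \<open>X\<close>. The outer
  \<open>restrict\<close> keeps the result extensional even when \<open>undefined\<close> is one of
  the swapped elements.\<close>

lemma swap_labelling:
  assumes "B \<in> labellings m X" "x \<in> X" "y \<in> X"
  shows "restrict (Transposition.transpose x y \<circ> B) {1..m} \<in> labellings m X"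
proof -
  have "bij_betw (Transposition.transpose x y) X X"
    using assms by (intro bij_betw_byWitness[where f' = "Transposition.transpose x y"])
      (auto simp: Transposition.transpose_def)
  then have "bij_betw (Transposition.transpose x y \<circ> B) {1..m} X"
    using assms(1) by (auto simp: labellings_def intro: bij_betw_trans)
  then show ?thesis
    by (simp add: labellings_def)
qed

lemma restrict_swap_swap:
  assumes "B \<in> extensional I"
  shows "restrict (Transposition.transpose x y \<circ> restrict (Transposition.transpose x y \<circ> B) I) I = B"
  by (rule extensionalityI[OF _ assms]) simp_all

text \<open>By symmetry: swapping the values \<open>x\<close> and \<open>y\<close> injects the
  labellings with \<open>B i = x\<close> into those with \<open>B i = y\<close>, and conversely, so
  all fibres of evaluation at \<open>i\<close> have the same size.\<close>

lemma map_labelling_uniform: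
  assumes "finite X" "card X = m" "i \<in> {1..m}"
  shows "map_pmf (\<lambda>B. B i) (pmf_of_set (labellings m X)) = pmf_of_set X"
proof -
  let ?L = "labellings m X"
  let ?F = "\<lambda>x. {B \<in> ?L. B i = x}"
  have le: "card (?F x) \<le> card (?F y)" if "x \<in> X" "y \<in> X" for x y
  proof (rule card_inj_on_le)
    let ?t = "\<lambda>B. restrict (Transposition.transpose x y \<circ> B) {1..m}"
    show "inj_on ?t (?F x)"
    proof (rule inj_on_inverseI)
      fix B assume "B \<in> ?F x"
      then show "?t (?t B) = B"
        by (intro restrict_swap_swap) (simp add: labellings_def)
    qed
    show "?t ` ?F x \<subseteq> ?F y"
    proof
      fix C assume "C \<in> ?t ` ?F x"
      then obtain B where "B \<in> ?L" "B i = x" "C = ?t B"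
        by blast
      then show "C \<in> ?F y"
        using swap_labelling[OF _ that] assms(3) by simp
    qed
    show "finite (?F y)"
      using finite_labellings[OF assms(1)] by simp
  qed
  have eq: "card (?F x) = card (?F y)" if "x \<in> X" "y \<in> X" for x y
    using le that by (simp add: le_antisym)
  \<comment> \<open>One reference labelling serves twice: swapping its value at \<open>i\<close>
    with \<open>x\<close> shows that every \<open>x\<close> is attained, and its fibre supplies the
    common size.\<close>
  obtain B0 where B0: "B0 \<in> ?L"
    using labellings_nonempty[OF assms(1,2)] by blast
  then have B0i: "B0 i \<in> X"
    using assms(3) by (auto simp: labellings_def dest: bij_betwE)
  have "(\<lambda>B. B i) ` ?L = X"
  proof
    show "(\<lambda>B. B i) ` ?L \<subseteq> X"
      using assms(3) by (auto simp: labellings_def dest: bij_betwE)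
    show "X \<subseteq> (\<lambda>B. B i) ` ?L"
    proof
      fix x assume "x \<in> X"
      then have "restrict (Transposition.transpose (B0 i) x \<circ> B0) {1..m} \<in> ?L"
        by (intro swap_labelling B0 B0i)
      then show "x \<in> (\<lambda>B. B i) ` ?L"
        by (rule rev_image_eqI) (use assms(3) in simp)
    qed
  qed
  then show ?thesis
    using finite_labellings[OF assms(1)] B0 eq[OF _ B0i]
    by (intro map_pmf_of_set_equal_fibres[where c = "card (?F (B0 i))"]) blast+
qed

section \<open>Counterimages of mutually orthogonal cellular automata\<close>

lemma finite_blocks: "finite (blocks k :: 'a::finite list set)"
  using finite_lists_length_eq[of "UNIV :: 'a set" k] by (simp add: blocks_def)

lemma card_blocks: "card (blocks k :: 'a::finite list set) = CARD('a) ^ k"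
  using card_lists_length_eq[of "UNIV :: 'a set" k] by (simp add: blocks_def)

lemma blocks_nonempty: "blocks k \<noteq> {}"
  by (simp add: blocks_def Ex_list_of_length)

lemma nbca_in_blocks: "nbca d g x \<in> blocks (d - 1)"
  by (simp add: nbca_def blocks_def)

lemma finite_counterimage: "finite (counterimage d (g :: 'a::finite list \<Rightarrow> 'a) y)"
  by (rule finite_subset[OF _ finite_blocks[of "2 * (d - 1)"]]) (auto simp: counterimage_def)

lemma append_take_drop_blocks:
  "u \<in> blocks k \<Longrightarrow> v \<in> blocks k \<Longrightarrow> u @ v \<in> blocks (2 * k)"
  "x \<in> blocks (2 * k) \<Longrightarrow> take k x \<in> blocks k"
  "x \<in> blocks (2 * k) \<Longrightarrow> drop k x \<in> blocks k"
  by (auto simp: blocks_def)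

text \<open>Row \<open>u\<close> of the Cayley table contains \<open>y\<close> exactly once, so each
  left half \<open>u\<close> extends to exactly one preimage of \<open>y\<close>; taking the left
  half is therefore a bijection onto \<open>blocks (d - 1)\<close>.\<close>

lemma card_counterimage:
  fixes g :: "'a::finite list \<Rightarrow> 'a"
  assumes "latin_square (blocks (d - 1)) (cayley_table d g)" "y \<in> blocks (d - 1)"
  shows "card (counterimage d g y) = CARD('a) ^ (d - 1)"
proof -
  let ?k = "d - 1"
  have row: "bij_betw (\<lambda>v. nbca d g (u @ v)) (blocks ?k) (blocks ?k)" if "u \<in> blocks ?k" for u
    using assms(1) that by (simp add: latin_square_def cayley_table_def)
  have "bij_betw (take ?k) (counterimage d g y) (blocks ?k)"
    unfolding bij_betw_def
  proof
    show "inj_on (take ?k) (counterimage d g y)"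
    proof (rule inj_onI)
      fix x x'
      assume x: "x \<in> counterimage d g y" and x': "x' \<in> counterimage d g y"
        and eq: "take ?k x = take ?k x'"
      have b: "x \<in> blocks (2 * ?k)" "x' \<in> blocks (2 * ?k)"
        using x x' by (auto simp: counterimage_def)
      \<comment> \<open>Rewriting only the second \<open>take ?k x\<close> reassembles the two
        arguments into \<open>x\<close> and \<open>x'\<close>, both of which have image
        \<open>y\<close>.\<close>
      have "nbca d g (take ?k x @ drop ?k x) = nbca d g (take ?k x @ drop ?k x')"
        using x x' by (subst (2) eq) (simp add: counterimage_def)
      moreover have "inj_on (\<lambda>v. nbca d g (take ?k x @ v)) (blocks ?k)"
        using row append_take_drop_blocks(2) b(1) bij_betw_imp_inj_on by blast
      ultimately have "drop ?k x = drop ?k x'"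
        using append_take_drop_blocks(3) b by (blast dest: inj_onD)
      with eq show "x = x'"
        by (metis append_take_drop_id)
    qed
    show "take ?k ` counterimage d g y = blocks ?k"
    proof
      show "take ?k ` counterimage d g y \<subseteq> blocks ?k"
        using append_take_drop_blocks(2) by (auto simp: counterimage_def)
      show "blocks ?k \<subseteq> take ?k ` counterimage d g y"
      proof
        fix u :: "'a list" assume u: "u \<in> blocks ?k"
        then obtain v where v: "v \<in> blocks ?k" "nbca d g (u @ v) = y"
          using bij_betw_imp_surj_on[OF row[OF u]] assms(2) by (metis imageE)
        have "u @ v \<in> counterimage d g y"
          using append_take_drop_blocks(1)[OF u v(1)] v(2) by (simp add: counterimage_def)
        then show "u \<in> take ?k ` counterimage d g y"
          by (rule rev_image_eqI) (use u in \<open>simp add: blocks_def\<close>)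
      qed
    qed
  qed
  then show ?thesis
    using bij_betw_same_card card_blocks by metis
qed

text \<open>The counterimages partition the input blocks into classes of equal size, so a uniform
  class followed by a uniform element of it is a uniform input block, whatever the rule.\<close>

lemma uniform_counterimage:
  fixes g :: "'a::finite list \<Rightarrow> 'a"
  assumes "latin_square (blocks (d - 1)) (cayley_table d g)"
  shows "bind_pmf (pmf_of_set (blocks (d - 1))) (\<lambda>y. pmf_of_set (counterimage d g y)) =
    pmf_of_set (blocks (2 * (d - 1)))"
proof -
  have card: "card (counterimage d g y) = CARD('a) ^ (d - 1)" if "y \<in> blocks (d - 1)" for y
    using card_counterimage[OF assms that] .
  have nonempty: "counterimage d g y \<noteq> {}" if "y \<in> blocks (d - 1)" for y
    using card[OF that] by (metis card.empty power_not_zero zero_less_card_finite less_numeral_extra(3))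
  have UN: "(\<Union>y\<in>blocks (d - 1). counterimage d g y) = blocks (2 * (d - 1))"
    using nbca_in_blocks by (auto simp: counterimage_def)
  have "pmf_of_set (\<Union>y\<in>blocks (d - 1). counterimage d g y) =
      bind_pmf (pmf_of_set (blocks (d - 1))) (\<lambda>y. pmf_of_set (counterimage d g y))"
    using card nonempty blocks_nonempty
    by (intro pmf_of_set_UN[where n = "CARD('a) ^ (d - 1)"])
      (simp_all add: UN finite_blocks finite_counterimage, auto simp: disjoint_family_on_def counterimage_def)
  then show ?thesis
    by (simp only: UN)
qed

text \<open>In \<open>moca\<close> the Latin property is stated only for pairs of distinct indices,
  so a second index is needed; \<open>n \<ge> 2\<close> provides it.\<close>

lemma moca_latin_square:
  assumes "moca n d f" "n \<ge> 2" "k \<in> {1..n}"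
  shows "latin_square (blocks (d - 1)) (cayley_table d (f k))"
proof -
  have "\<exists>l\<in>{1..n}. l \<noteq> k"
    using assms(2) by (intro bexI[of _ "if k = 1 then 2 else 1"]) auto
  then show ?thesis
    using assms unfolding moca_def orthogonal_latin_squares_def by blast
qed

text \<open>The combinatorial core. Cut into halves, \<open>x\<close> and \<open>x'\<close> are two
  cells of the Cayley tables; for \<open>k \<noteq> l\<close>, equal pairs of entries would force
  the cells to coincide by orthogonality.\<close>

lemma moca_rule_unique:
  assumes "moca n d f" "k \<in> {1..n}" "l \<in> {1..n}"
    and x: "x \<in> blocks (2 * (d - 1))" "x' \<in> blocks (2 * (d - 1))" "x \<noteq> x'"
    and eq: "nbca d (f k) x = nbca d (f k) x'" "nbca d (f l) x = nbca d (f l) x'"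
  shows "k = l"
proof (rule ccontr)
  let ?k = "d - 1"
  assume "k \<noteq> l"
  then have inj: "inj_on (\<lambda>(u, v). (nbca d (f k) (u @ v), nbca d (f l) (u @ v)))
      (blocks ?k \<times> blocks ?k)"
    using assms(1-3) by (simp add: moca_def orthogonal_latin_squares_def cayley_table_def)
  have "(take ?k x, drop ?k x) = (take ?k x', drop ?k x')"
    by (rule inj_onD[OF inj]) (use eq x append_take_drop_blocks in auto)
  then show False
    using x(3) by (metis append_take_drop_id prod.inject)
qed

section \<open>Shares and recovery in the MOCA scheme\<close>

text \<open>\<open>pmf_of_set\<close> has the intended support only for a finite nonempty set. The
  Latin property makes each counterimage as large as the set of players, so labellings
  exist.\<close>

lemma set_pmf_deal:
  fixes f :: "nat \<Rightarrow> 'a::finite list \<Rightarrow> 'a"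
  assumes "latin_square (blocks (d - 1)) (cayley_table d (f s))"
  shows "set_pmf (deal (moca_scheme n d f) s) =
    (\<Union>R\<in>blocks (d - 1). labellings (CARD('a) ^ (d - 1)) (counterimage d (f s) R))"
  using card_counterimage[OF assms]
  by (simp add: moca_scheme_def set_bind_pmf finite_blocks blocks_nonempty finite_labellings
      finite_counterimage labellings_nonempty)

text \<open>Given \<open>R\<close>, the random labelling makes the share uniform on the counterimage
  of \<open>R\<close>; averaging over \<open>R\<close> removes every trace of
  \<open>s\<close>.\<close>

lemma map_deal_single:
  fixes f :: "nat \<Rightarrow> 'a::finite list \<Rightarrow> 'a"
  assumes "latin_square (blocks (d - 1)) (cayley_table d (f s))"
    and "i \<in> {1..CARD('a) ^ (d - 1)}"
  shows "map_pmf (\<lambda>B. B i) (deal (moca_scheme n d f) s) = pmf_of_set (blocks (2 * (d - 1)))"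
proof -
  have "map_pmf (\<lambda>B. B i) (deal (moca_scheme n d f) s) =
      bind_pmf (pmf_of_set (blocks (d - 1))) (\<lambda>R. map_pmf (\<lambda>B. B i)
        (pmf_of_set (labellings (CARD('a) ^ (d - 1)) (counterimage d (f s) R))))"
    by (simp add: moca_scheme_def map_bind_pmf)
  also have "\<dots> = bind_pmf (pmf_of_set (blocks (d - 1))) (\<lambda>R. pmf_of_set (counterimage d (f s) R))"
    using card_counterimage[OF assms(1)] assms(2)
    by (intro bind_pmf_cong refl map_labelling_uniform finite_counterimage)
      (auto simp: finite_blocks blocks_nonempty)
  also have "\<dots> = pmf_of_set (blocks (2 * (d - 1)))"
    by (rule uniform_counterimage[OF assms(1)])
  finally show ?thesis .
qed

text \<open>\<open>D\<close> is obtained before \<open>s\<close> is fixed, so one law serves all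
  rules. The empty coalition sees a constant, and a single player sees only one uniform
  share.\<close>

lemma small_coalition_view:
  fixes f :: "nat \<Rightarrow> 'a::finite list \<Rightarrow> 'a"
  assumes "U \<subseteq> {1..CARD('a) ^ (d - 1)}" "card U < 2"
  obtains D where "\<And>s. latin_square (blocks (d - 1)) (cayley_table d (f s)) \<Longrightarrow>
    map_pmf (\<lambda>B. restrict B U) (deal (moca_scheme n d f) s) = D"
proof -
  have "finite U"
    using assms(1) finite_subset by blast
  then consider "U = {}" | i where "U = {i}"
    using assms(2) by (metis One_nat_def card_0_eq card_1_singletonE less_2_cases)
  then show thesis
  proof cases
    case 1
    then show thesis
      by (intro that[of "return_pmf (\<lambda>_. undefined)"]) (simp add: restrict_def)
  next
    case (2 i)
    then have i: "i \<in> {1..CARD('a) ^ (d - 1)}"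
      using assms(1) by simp
    \<comment> \<open>The view of a single player factors through the value of the share, which
      reduces its law to \<open>map_deal_single\<close>.\<close>
    have view: "(\<lambda>B. restrict B U) = (\<lambda>b. restrict (\<lambda>_. b) {i}) \<circ> (\<lambda>B. B i)"
      using 2 by (auto simp: fun_eq_iff)
    have "map_pmf (\<lambda>B. restrict B U) (deal (moca_scheme n d f) s) =
        map_pmf (\<lambda>b. restrict (\<lambda>_. b) {i}) (map_pmf (\<lambda>B. B i) (deal (moca_scheme n d f) s))" for s
      unfolding view by (rule pmf.map_comp[symmetric])
    then show thesis
      by (intro that) (simp add: map_deal_single[OF _ i])
  qed
qed

text \<open>Packages what recovery uses about the dealer: distinct players hold distinct blocks, and
  the secret rule agrees on all of them.\<close>

lemma deal_shares:
  fixes f :: "nat \<Rightarrow> 'a::finite list \<Rightarrow> 'a"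
  assumes "latin_square (blocks (d - 1)) (cayley_table d (f s))"
    and "B \<in> set_pmf (deal (moca_scheme n d f) s)"
  obtains R where "inj_on B {1..CARD('a) ^ (d - 1)}"
    and "\<And>i. i \<in> {1..CARD('a) ^ (d - 1)} \<Longrightarrow> B i \<in> blocks (2 * (d - 1)) \<and> nbca d (f s) (B i) = R"
proof -
  obtain R where B: "bij_betw B {1..CARD('a) ^ (d - 1)} (counterimage d (f s) R)"
    using assms(2) unfolding set_pmf_deal[where f = f, OF assms(1)] labellings_def by blast
  show thesis
    using B bij_betwE[OF B] by (intro that[of R]) (auto simp: bij_betw_def counterimage_def)
qed

text \<open>A multiset argument, without player labels, makes this one function usable for every
  authorized set, as anonymity demands.\<close>

definition rule_of_shares :: "nat \<Rightarrow> nat \<Rightarrow> (nat \<Rightarrow> 'a list \<Rightarrow> 'a) \<Rightarrow> 'a list multiset \<Rightarrow> nat" where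
  "rule_of_shares n d f M = (THE k. k \<in> {1..n} \<and> (\<exists>R. \<forall>b\<in>#M. nbca d (f k) b = R))"

text \<open>The secret rule is constant on the shares. Any other candidate also agrees on two
  distinct shares, hence equals \<open>s\<close> by \<open>moca_rule_unique\<close>.\<close>

lemma rule_of_shares_eq:
  fixes f :: "nat \<Rightarrow> 'a::finite list \<Rightarrow> 'a"
  assumes "moca n d f" "n \<ge> 2" "s \<in> {1..n}" "B \<in> set_pmf (deal (moca_scheme n d f) s)"
    and U: "U \<subseteq> {1..CARD('a) ^ (d - 1)}" "2 \<le> card U"
  shows "rule_of_shares n d f (image_mset B (mset_set U)) = s"
proof -
  note latin = moca_latin_square[OF assms(1-3)]
  obtain R where inj: "inj_on B {1..CARD('a) ^ (d - 1)}"
    and R: "\<And>i. i \<in> {1..CARD('a) ^ (d - 1)} \<Longrightarrow>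
      B i \<in> blocks (2 * (d - 1)) \<and> nbca d (f s) (B i) = R"
    using deal_shares[where f = f, OF latin assms(4)] by blast
  have fin: "finite U"
    using U(1) finite_subset by blast
  obtain i j where ij: "i \<in> U" "j \<in> U" "i \<noteq> j"
    using U(2) fin by (metis card_le_Suc0_iff_eq not_less_eq_eq numeral_2_eq_2)
  show ?thesis
    unfolding rule_of_shares_def
  proof (rule the_equality)
    show "s \<in> {1..n} \<and> (\<exists>R. \<forall>b\<in>#image_mset B (mset_set U). nbca d (f s) b = R)"
      using assms(3) R U(1) fin by (intro conjI exI[of _ R]) auto
    fix k assume k: "k \<in> {1..n} \<and> (\<exists>R. \<forall>b\<in>#image_mset B (mset_set U). nbca d (f k) b = R)"
    have "B i \<noteq> B j"
      using inj ij U(1) by (meson inj_onD subsetD)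
    moreover have "nbca d (f k) (B i) = nbca d (f k) (B j)"
      using k ij fin by auto
    ultimately show "k = s"
      using moca_rule_unique[OF assms(1), of k s "B i" "B j"] k R[of i] R[of j] ij U(1) assms(3)
      by (auto simp: subset_iff)
  qed
qed

text \<open>A set common to both families is a class containing \<open>b\<close> and
  \<open>b'\<close>, and only the rule \<open>s\<close> has such a class.\<close>

lemma identifies_iff:
  assumes "moca n d f" "s \<in> {1..n}"
    and b: "b \<in> blocks (2 * (d - 1))" "b' \<in> blocks (2 * (d - 1))" "b \<noteq> b'"
    and eq: "nbca d (f s) b = nbca d (f s) b'"
  shows "identifies n d f b b' k \<longleftrightarrow> k = s"
proof -
  let ?X = "counterimage d (f s) (nbca d (f s) b)"
  have unique: "l = s" if "l \<in> {1..n}" "nbca d (f l) b = nbca d (f l) b'" for l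
    using moca_rule_unique[OF assms(1) that(1) assms(2) b that(2) eq] .
  have inter: "share_family n d f b \<inter> share_family n d f b' = {?X}"
  proof
    show "{?X} \<subseteq> share_family n d f b \<inter> share_family n d f b'"
      using assms(2) by (auto simp: share_family_def eq intro!: image_eqI[of _ _ s])
    show "share_family n d f b \<inter> share_family n d f b' \<subseteq> {?X}"
    proof
      fix X assume "X \<in> share_family n d f b \<inter> share_family n d f b'"
      then obtain l l' where l: "l \<in> {1..n}" "X = counterimage d (f l) (nbca d (f l) b)"
        and l': "X = counterimage d (f l') (nbca d (f l') b')"
        by (auto simp: share_family_def)
      \<comment> \<open>The indices \<open>l\<close> and \<open>l'\<close> may differ a priori.
        Since \<open>X\<close> is also a class of \<open>b'\<close>, it contains \<open>b'\<close>,
        so rule \<open>l\<close> agrees on both blocks and \<open>l = s\<close>.\<close>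
      have "b' \<in> X"
        using b(2) by (simp add: l' counterimage_def)
      then have "nbca d (f l) b = nbca d (f l) b'"
        by (simp add: l(2) counterimage_def)
      then show "X \<in> {?X}"
        using unique l by blast
    qed
  qed
  \<comment> \<open>\<open>X\<close> is a bare set, so its membership in the partition of another
    rule must be excluded too; containing both \<open>b\<close> and \<open>b'\<close> rules this
    out.\<close>
  have "k = s" if k: "k \<in> {1..n}" "?X \<in> ca_partition d (f k)"
  proof -
    obtain y where y: "?X = counterimage d (f k) y"
      using k(2) by (auto simp: ca_partition_def)
    have "b \<in> ?X" "b' \<in> ?X"
      using b eq by (simp_all add: counterimage_def)
    then have "nbca d (f k) b = nbca d (f k) b'"
      unfolding y by (simp add: counterimage_def)
    then show ?thesis
      by (rule unique[OF k(1)])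
  qed
  moreover have "?X \<in> ca_partition d (f s)"
    using nbca_in_blocks by (auto simp: ca_partition_def)
  ultimately show ?thesis
    using assms(2) unfolding identifies_def inter by auto
qed

theorem lemma2:
  fixes f :: "nat \<Rightarrow> 'a::finite list \<Rightarrow> 'a" and q d n :: nat
  assumes "CARD('a) = q"
    and "d \<ge> 2"
    and "n \<ge> 2"
    and "\<And>i. i \<in> {1..n} \<Longrightarrow> bipermutive d (f i)"
    and "moca n d f"
  shows "threshold_scheme 2 (q ^ (d - 1)) (moca_scheme n d f) \<and>
         perfect_scheme (moca_scheme n d f) \<and>
         anonymous_scheme (moca_scheme n d f) \<and>
         recovery_correct n d f"
proof -
  let ?S = "moca_scheme n d f"
  have secrets: "secrets ?S = {1..n}" and players: "players ?S = {1..CARD('a) ^ (d - 1)}"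
    by (simp_all add: moca_scheme_def)
  note latin = moca_latin_square[OF assms(5,3)]
  note recover = rule_of_shares_eq[OF assms(5,3)]
  have view: "\<exists>D. \<forall>s\<in>secrets ?S. map_pmf (\<lambda>B. restrict B U) (deal ?S s) = D"
    if "U \<subseteq> players ?S" "card U < 2" for U
    using small_coalition_view[of U d f n] that latin unfolding players secrets by metis
  have authorized: "can_recover ?S U \<longleftrightarrow> 2 \<le> card U" if U: "U \<subseteq> players ?S" for U
  proof
    assume "2 \<le> card U"
    \<comment> \<open>\<open>can_recover\<close> passes the restricted assignment to the recovery
      function; on \<open>U\<close> this changes no share, so the pooled multiset is the
      same.\<close>
    moreover have "image_mset (restrict B U) (mset_set U) = image_mset B (mset_set U)" for B :: "nat \<Rightarrow> 'a list"
      using U finite_subset[of U] by (intro image_mset_cong) (auto simp: players)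
    ultimately have "rule_of_shares n d f (image_mset (restrict B U) (mset_set U)) = s"
      if "s \<in> secrets ?S" "B \<in> set_pmf (deal ?S s)" for s B
      using that U recover unfolding players secrets by simp
    then show "can_recover ?S U"
      unfolding can_recover_def
      by (intro exI[of _ "\<lambda>B. rule_of_shares n d f (image_mset B (mset_set U))"]) blast
  next
    assume "can_recover ?S U"
    \<comment> \<open>Two different secrets with the same view law contradict recoverability when
      \<open>card U < 2\<close>.\<close>
    moreover have "1 \<in> secrets ?S" "2 \<in> secrets ?S"
      using assms(3) by (auto simp: secrets)
    ultimately show "2 \<le> card U"
      using view[OF U] not_can_recover[of ?S U _ 1 2] by (metis not_le one_eq_numeral_iff semiring_norm(85))
  qed
  have "threshold_scheme 2 (q ^ (d - 1)) ?S"
    using authorized assms(1) by (simp add: threshold_scheme_def players)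
  moreover have "perfect_scheme ?S"
    unfolding perfect_scheme_def
  proof (intro allI impI ballI)
    fix p U v s
    assume p: "set_pmf p \<subseteq> secrets ?S" and U: "U \<subseteq> players ?S" "\<not> can_recover ?S U"
      and pos: "0 < \<P>(\<omega> in secret_and_shares p ?S. restrict (snd \<omega>) U = v)"
    \<comment> \<open>By \<open>authorized\<close>, an unauthorized set has fewer than two players,
      so its view law is independent of the secret.\<close>
    obtain D where "\<And>s. s \<in> secrets ?S \<Longrightarrow> map_pmf (\<lambda>B. restrict B U) (deal ?S s) = D"
      using view[OF U(1)] authorized[OF U(1)] U(2) by auto
    then show "\<P>(\<omega> in secret_and_shares p ?S. fst \<omega> = s \<bar> restrict (snd \<omega>) U = v) = pmf p s"
      using cond_prob_secret[OF p _ pos] by blast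
  qed
  \<comment> \<open>The function \<open>rule_of_shares n d f\<close> does not depend on
    \<open>U\<close>, so it is the required common witness.\<close>
  moreover have "anonymous_scheme ?S"
    unfolding anonymous_scheme_def
    using authorized recover unfolding players secrets by blast
  moreover have "recovery_correct n d f"
    unfolding recovery_correct_def
  proof (intro ballI impI allI)
    fix s B i j k
    assume s: "s \<in> secrets ?S" and B: "B \<in> set_pmf (deal ?S s)"
      and ij: "i \<in> players ?S" "j \<in> players ?S" "i \<noteq> j"
    have s': "s \<in> {1..n}"
      using s by (simp add: secrets)
    obtain R where inj: "inj_on B (players ?S)"
      and R: "\<And>i. i \<in> players ?S \<Longrightarrow> B i \<in> blocks (2 * (d - 1)) \<and> nbca d (f s) (B i) = R"
      using deal_shares[where f = f, OF latin[OF s'] B] unfolding players by blast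
    have "B i \<noteq> B j"
      using inj ij by (meson inj_onD)
    then show "identifies n d f (B i) (B j) k \<longleftrightarrow> k = s"
      using R ij by (intro identifies_iff[OF assms(5) s']) auto
  qed
  ultimately show ?thesis
    by blast
qed

end
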